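(* Let $q\ge 1$ and let $\mathbf z=(z_1,\ldots,z_q)\in[0,1]^{2q}$ be a vertex of the bishops' inside-out polytope $([0,1]^{2q},\mathscr A_{\mathbb B})$. Then for each $i=1,\ldots,q$, either $z_i\in\{0,1\}^2$ or $z_i=(\frac12,\frac12)$.
   Context: Coordinates on $\mathbb R^{2q}$ are written $(x_1,y_1,\ldots,x_q,y_q)$, with $z_i=(x_i,y_i)$ and $\mathbf z=(z_1,\ldots,z_q)$. The bishops' move arrangement $\mathscr A_{\mathbb B}$ is the finite set of hyperplanes in $\mathbb R^{2q}$ $$\mathcal H_{ij}^+=\{\mathbf z: x_i-y_i=x_j-y_j\},\qquad \mathcal H_{ij}^-=\{\mathbf z: x_i+y_i=x_j+y_j\},\qquad 1\le i<j\le q.$$ The equations of these hyperplanes are the attack equations. The boundary equations of the cube $[0,1]^{2q}$ are the equations $x_i=0$, $x_i=1$, $y_i=0$, $y_i=1$ for $1\le i\le q$. The bishops' inside-out polytope is the pair $([0,1]^{2q},\mathscr A_{\mathbb B})$. A vertex of it is a point of $[0,1]^{2q}$ that is the unique solution in $\mathbb R^{2q}$ of a system consisting of $k$ attack equations and $2q-k$ boundary equations, for some $k$. *)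

theory Defs
  imports "HOL-Analysis.Analysis"
begin

text \<open>
  The index set $\{1,\ldots,q\}$ is a finite type \<open>'q\<close> (so $q = $ \<open>CARD('q)\<close> $\ge 1$), and
  $\mathbb{R}^{2q}$ is \<open>(real \<times> real) ^ 'q\<close>, with $z_i = (x_i, y_i)$ being \<open>z $ i\<close>.
  A linear equation is represented by its solution set; no two different attack or boundary
  equations have the same solution set.
\<close>

type_synonym 'q config = "(real \<times> real) ^ 'q"

definition H_plus :: "'q::finite \<Rightarrow> 'q \<Rightarrow> 'q config set" where
  "H_plus i j = {z. fst (z $ i) - snd (z $ i) = fst (z $ j) - snd (z $ j)}"

definition H_minus :: "'q::finite \<Rightarrow> 'q \<Rightarrow> 'q config set" where
  "H_minus i j = {z. fst (z $ i) + snd (z $ i) = fst (z $ j) + snd (z $ j)}"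

text \<open>
  Both kinds of hyperplane are symmetric in \<open>i\<close> and \<open>j\<close>, so ranging over \<open>i \<noteq> j\<close> gives the same
  set as ranging over \<open>i < j\<close>, without fixing an order on \<open>'q\<close>.
\<close>

definition bishops_arrangement :: "'q::finite config set set" where
  "bishops_arrangement =
     {H_plus i j | i j. i \<noteq> j} \<union> {H_minus i j | i j. i \<noteq> j}"

definition unit_cube :: "'q::finite config set" where
  "unit_cube = {z. \<forall>i. z $ i \<in> {0..1} \<times> {0..1}}"

definition cube_boundary :: "'q::finite config set set" where
  "cube_boundary =
     {{z. fst (z $ i) = c} | i c. c \<in> {0, 1}} \<union> {{z. snd (z $ i) = c} | i c. c \<in> {0, 1}}"

definition bishops_vertices :: "'q::finite config set" where
  "bishops_vertices =
     {z \<in> unit_cube. \<exists>k \<le> 2 * CARD('q). \<exists>A \<subseteq> bishops_arrangement. \<exists>B \<subseteq> cube_boundary.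
        card A = k \<and> card B = 2 * CARD('q) - k \<and> \<Inter>A \<inter> \<Inter>B = {z}}"

end

(* The perturbation (x, y) |-> (x + sin (pi x) cos (pi y), y + cos (pi x) sin (pi y)), applied to
   every piece, preserves each attack and boundary equation that holds at a given configuration:
   it acts on both x - y and x + y as t |-> t + sin (pi t), and it fixes x when x is an integer
   and y when y is an integer. By uniqueness it fixes a vertex, so sin (pi x) cos (pi y) and
   cos (pi x) sin (pi y) vanish at every piece. *)
theory Submission
  imports Defs
begin

definition perturb :: "real \<times> real \<Rightarrow> real \<times> real" where
  "perturb p = (fst p + sin (pi * fst p) * cos (pi * snd p),
                snd p + cos (pi * fst p) * sin (pi * snd p))"

lemma perturb_diff:
  "fst (perturb p) - snd (perturb p) = (fst p - snd p) + sin (pi * (fst p - snd p))"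
  by (simp add: perturb_def right_diff_distrib sin_diff)

lemma perturb_sum:
  "fst (perturb p) + snd (perturb p) = (fst p + snd p) + sin (pi * (fst p + snd p))"
  by (simp add: perturb_def distrib_left sin_add)

text \<open>The new \<open>x - y\<close> of a piece is a function of its old \<open>x - y\<close>
  alone, and likewise for \<open>x + y\<close>, so two pieces that agree in one of these quantities
  still agree in it.\<close>

lemma perturb_mem_arrangement:
  assumes "H \<in> bishops_arrangement" "z \<in> H"
  shows "(\<chi> i. perturb (z $ i)) \<in> H"
  using assms
  by (auto simp: bishops_arrangement_def H_plus_def H_minus_def perturb_diff perturb_sum)

lemma perturb_mem_boundary:
  assumes "F \<in> cube_boundary" "z \<in> F"
  shows "(\<chi> i. perturb (z $ i)) \<in> F"
  using assms by (auto simp: cube_boundary_def perturb_def)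

lemma sin_pi_mult_eq_0D:
  fixes x :: real
  assumes "sin (pi * x) = 0" "x \<in> {0..1}"
  shows "x = 0 \<or> x = 1"
proof (rule ccontr)
  assume "\<not> ?thesis"
  with assms(2) have "0 < pi * x" "pi * x < pi" by auto
  then show False using sin_gt_zero[of "pi * x"] assms(1) by simp
qed

lemma cos_pi_mult_eq_0D:
  fixes x :: real
  assumes "cos (pi * x) = 0" "x \<in> {0..1}"
  shows "x = 1/2"
proof -
  have "pi * x = pi / 2"
    by (rule cos_inj_pi) (use assms in auto)
  then show ?thesis by (simp add: field_simps)
qed

lemma perturb_fixed_pointD:
  assumes "perturb p = p" "p \<in> {0..1} \<times> {0..1}"
  shows "p \<in> {0, 1} \<times> {0, 1} \<or> p = (1/2, 1/2)"
proof -
  obtain x y where p: "p = (x, y)" by fastforce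
  have xy: "x \<in> {0..1}" "y \<in> {0..1}" using assms(2) p by auto
  \<comment> \<open>Each displacement is a product, so one of its two factors vanishes. A coordinate
    equal to 0 or 1 is not 1/2, so the two disjunctions together exclude mixed pairs such as
    \<open>(0, 1/2)\<close>.\<close>
  have "x = 0 \<or> x = 1 \<or> y = 1/2" "x = 1/2 \<or> y = 0 \<or> y = 1"
    using assms(1) p xy sin_pi_mult_eq_0D cos_pi_mult_eq_0D by (auto simp: perturb_def)
  then show ?thesis using p by auto
qed

theorem mainTheorem3:
  fixes z :: "(real \<times> real) ^ 'q::finite"
  assumes "z \<in> bishops_vertices"
  shows "\<forall>i. z $ i \<in> {0, 1} \<times> {0, 1} \<or> z $ i = (1/2, 1/2)"
proof
  fix i
  obtain A B where AB: "A \<subseteq> bishops_arrangement" "B \<subseteq> cube_boundary" "\<Inter>A \<inter> \<Inter>B = {z}"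
    using assms unfolding bishops_vertices_def by blast
  \<comment> \<open>The perturbed configuration may leave the cube: \<open>perturb\<close> sends
    \<open>(1/2, 0)\<close> to \<open>(3/2, 0)\<close>. This is harmless, since a vertex is the
    unique solution in the whole space.\<close>
  have "(\<chi> j. perturb (z $ j)) \<in> \<Inter>A \<inter> \<Inter>B"
    using AB perturb_mem_arrangement perturb_mem_boundary by blast
  with AB(3) have "perturb (z $ i) = z $ i"
    by (metis singletonD vec_lambda_beta)
  moreover have "z $ i \<in> {0..1} \<times> {0..1}"
    using assms unfolding bishops_vertices_def unit_cube_def by blast
  ultimately show "z $ i \<in> {0, 1} \<times> {0, 1} \<or> z $ i = (1/2, 1/2)"
    by (rule perturb_fixed_pointD)
qed

end
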